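(* Let $m\ge 1$, $N=2^m$, and let $P$ be a binary symmetric $m\times m$ matrix. For every $w\in\mathbb{F}_2^m$ the column vector $[\imath^{xPx^T+2wx^T}]_{x\in\mathbb{F}_2^m}\in\mathbb{C}^N$ is a common eigenvector of the maximal commutative subgroup $E([I_m\mid P])$ of $HW_N$. Each of these eigenvectors has Euclidean length $\sqrt{N}=2^{m/2}$.
   Context: $\imath=\sqrt{-1}$. Coordinates of $\mathbb{C}^N$ are indexed by binary row vectors $x\in\mathbb{F}_2^m$, and $\{e_x\}$ is the standard basis. In the exponent $xPx^T+2wx^T$ all entries are regarded as integers $0,1$ and the value is taken modulo 4. With $X=\begin{bmatrix}0&1\\1&0\end{bmatrix}$, $Z=\begin{bmatrix}1&0\\0&-1\end{bmatrix}$, for $a,b\in\mathbb{F}_2^m$ set $D(a,b)=X^{a_1}Z^{b_1}\otimes\cdots\otimes X^{a_m}Z^{b_m}$ (so $D(a,b)e_v=(-1)^{bv^T}e_{v+a}$). The Heisenberg-Weyl (Pauli) group is $HW_N=\{\imath^{\kappa}D(a,b): a,b\in\mathbb{F}_2^m,\kappa\in\mathbb{Z}_4\}$. $E(a,b)=\imath^{ab^T}D(a,b)$ (with $ab^T$ computed over the integers, modulo 4) is the corresponding Hermitian Pauli matrix. For a binary symmetric matrix $P$, $E([I_m\mid P])$ denotes the maximal commutative subgroup of $HW_N$ generated by the matrices $E(r,s)$ where $[r,s]$ runs over the rows of $[I_m\mid P]$; up to sign its elements are $E(a,aP)$, $a\in\mathbb{F}_2^m$ ($aP$ computed over $\mathbb{F}_2$).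 *)

theory Defs
  imports "HOL-Analysis.Analysis" "HOL-Library.Z2" "HOL-Algebra.Generated_Groups"
begin

lemma UNIV_bit: "(UNIV :: bit set) = {0, 1}"
  by (auto intro: bit.exhaust)

instance bit :: finite
  by standard (simp add: UNIV_bit)

text \<open>
  The field with two elements is \<^typ>\<open>bit\<close>, and \<open>'m\<close> is the index type of the \<open>m\<close> binary
  coordinates, so \<open>m = CARD('m) \<ge> 1\<close>. Vectors and matrices of size \<open>N = 2^m\<close> are indexed by
  \<^typ>\<open>bit ^ 'm\<close>.
\<close>

type_synonym 'm state = "complex ^ (bit ^ 'm)"
type_synonym 'm operator = "complex ^ (bit ^ 'm) ^ (bit ^ 'm)"

definition pauli_X :: "complex ^ bit ^ bit" where
  "pauli_X = (\<chi> i j. if i = j then 0 else 1)"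

definition pauli_Z :: "complex ^ bit ^ bit" where
  "pauli_Z = (\<chi> i j. if i \<noteq> j then 0 else if i = 0 then 1 else -1)"

text \<open>The overloaded power and \<open>1\<close> on vectors act componentwise, hence a separate matrix power.\<close>

definition mpow :: "'a::semiring_1 ^ 'n ^ 'n \<Rightarrow> nat \<Rightarrow> 'a ^ 'n ^ 'n" where
  "mpow A k = (((**) A) ^^ k) (mat 1)"

text \<open>
  Kronecker product of a family of \<open>2 \<times> 2\<close> matrices. Since rows and columns are indexed by
  binary vectors rather than by numbers, no ordering of the tensor factors is needed.
\<close>

definition kron :: "('m::finite \<Rightarrow> complex ^ bit ^ bit) \<Rightarrow> 'm operator" where
  "kron M = (\<chi> u v. \<Prod>i\<in>UNIV. M i $ (u $ i) $ (v $ i))"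

definition D :: "bit ^ 'm::finite \<Rightarrow> bit ^ 'm \<Rightarrow> 'm operator" where
  "D a b = kron (\<lambda>i. mpow pauli_X (of_bit (a $ i)) ** mpow pauli_Z (of_bit (b $ i)))"

definition cscale :: "complex \<Rightarrow> complex ^ 'n ^ 'k \<Rightarrow> complex ^ 'n ^ 'k" where
  "cscale c A = map_matrix (\<lambda>z. c * z) A"

text \<open>
  Below, entries of binary vectors and matrices are lifted to the natural numbers \<open>0, 1\<close>.
  The exponents are used only in powers of \<open>\<i>\<close>, so they matter only modulo 4.
\<close>

definition dotn :: "bit ^ 'm::finite \<Rightarrow> bit ^ 'm \<Rightarrow> nat" where
  "dotn a b = (\<Sum>i\<in>UNIV. of_bit (a $ i) * of_bit (b $ i))"

definition quadn :: "bit ^ 'm::finite ^ 'm \<Rightarrow> bit ^ 'm \<Rightarrow> nat" where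
  "quadn P x = (\<Sum>i\<in>UNIV. \<Sum>j\<in>UNIV. of_bit (x $ i) * of_bit (P $ i $ j) * of_bit (x $ j))"

definition E :: "bit ^ 'm::finite \<Rightarrow> bit ^ 'm \<Rightarrow> 'm operator" where
  "E a b = cscale (\<i> ^ dotn a b) (D a b)"

definition HW :: "('m::finite operator) monoid" where
  "HW = \<lparr>carrier = {cscale (\<i> ^ k) (D a b) | (k::nat) a b. k < 4},
         monoid.mult = (**), one = mat 1\<rparr>"

text \<open>The \<open>i\<close>-th row of \<open>[I | P]\<close> is the pair of the \<open>i\<close>-th rows of \<open>I\<close> and \<open>P\<close>.\<close>

definition E_group :: "bit ^ 'm::finite ^ 'm \<Rightarrow> ('m operator) set" where
  "E_group P = generate HW {E (row i (mat 1)) (row i P) | i. True}"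

definition eigvec :: "bit ^ 'm::finite ^ 'm \<Rightarrow> bit ^ 'm \<Rightarrow> 'm state" where
  "eigvec P w = (\<chi> x. \<i> ^ (quadn P x + 2 * dotn w x))"

definition common_eigenvector ::
    "(complex ^ 'n ^ 'n) set \<Rightarrow> complex ^ 'n \<Rightarrow> bool" where
  "common_eigenvector S v \<longleftrightarrow> v \<noteq> 0 \<and> (\<forall>A\<in>S. \<exists>c. A *v v = c *s v)"

definition bsign :: "bit ^ 'm::finite \<Rightarrow> bit ^ 'm \<Rightarrow> complex" where
  "bsign b v = (-1) ^ dotn b v"

lemma mpow_0 [simp]: "mpow A 0 = mat 1" and mpow_1 [simp]: "mpow A (Suc 0) = A"
  by (simp_all add: mpow_def)

lemma XZ_entry:
  "(mpow pauli_X (of_bit a) ** mpow pauli_Z (of_bit b)) $ i $ j =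
     (if i = j + a then (-1) ^ (of_bit b * of_bit j) else 0)"
  by (cases a; cases b; cases i; cases j)
     (simp_all add: matrix_matrix_mult_def pauli_X_def pauli_Z_def UNIV_bit mat_def)

lemma D_entry: "D a b $ u $ v = (if u = v + a then bsign b v else 0)"
proof (cases "u = v + a")
  case True
  then show ?thesis
    by (simp only: D_def kron_def XZ_entry bsign_def dotn_def power_sum vec_lambda_beta
        vector_add_component if_True refl cong: prod.cong)
next
  case False
  then obtain i where "u $ i \<noteq> v $ i + a $ i"
    by (auto simp: vec_eq_iff simp del: add_bit_eq_xor)
  then have "\<exists>i\<in>UNIV. (mpow pauli_X (of_bit (a $ i)) ** mpow pauli_Z (of_bit (b $ i)))
      $ (u $ i) $ (v $ i) = 0"
    by (intro bexI[of _ i]) (simp_all only: XZ_entry if_False UNIV_I)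
  then have "(\<Prod>i\<in>UNIV. (mpow pauli_X (of_bit (a $ i)) ** mpow pauli_Z (of_bit (b $ i)))
      $ (u $ i) $ (v $ i)) = 0"
    by (intro prod_zero) auto
  with False show ?thesis
    by (simp add: D_def kron_def del: add_bit_eq_xor)
qed

lemma D_axis: "D a b *v axis v 1 = bsign b v *s axis (v + a) 1"
proof -
  have "(\<Sum>j\<in>UNIV. D a b $ u $ j * (if j = v then 1 else 0)) = D a b $ u $ v" for u
    by (simp add: if_distrib cong: if_cong)
  then have "(D a b *v axis v 1) $ u = D a b $ u $ v" for u
    by (simp only: matrix_vector_mult_def axis_def vec_lambda_beta)
  then have "(D a b *v axis v 1) $ u = (bsign b v *s axis (v + a) 1) $ u" for u
    by (simp only: D_entry vector_smult_component axis_def vec_lambda_beta) simp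
  then show ?thesis unfolding vec_eq_iff by blast
qed

lemma bit_vec_add_self: "x + x = 0" for x :: "bit ^ 'm"
proof -
  have "b + b = 0" for b :: bit by (cases b) auto
  then show ?thesis by (simp add: vec_eq_iff del: add_bit_eq_xor)
qed

lemma bsign_add_right: "bsign b (v + c) = bsign b v * bsign b c"
proof -
  have "(-1::complex) ^ (of_bit p * of_bit (q + r)) =
      (-1) ^ (of_bit p * of_bit q) * (-1) ^ (of_bit p * of_bit r)" for p q r :: bit
    by (cases p; cases q; cases r) simp_all
  then show ?thesis
    by (simp only: bsign_def dotn_def power_sum vector_add_component flip: prod.distrib)
qed

lemma dotn_commute: "dotn a b = dotn b a"
  by (simp add: dotn_def mult.commute)

lemma bsign_commute: "bsign a b = bsign b a"
  by (simp add: bsign_def dotn_commute)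

lemma bsign_add_left: "bsign (b + d) v = bsign b v * bsign d v"
  using bsign_add_right[of v b d] by (simp add: bsign_commute)

lemma bsign_zero [simp]: "bsign 0 v = 1" "bsign v 0 = 1"
  by (simp_all add: bsign_def dotn_def)

lemma bsign_cases: "bsign a b = 1 \<or> bsign a b = -1"
  by (cases "even (dotn a b)") (simp_all add: bsign_def)

lemma D_mult: "D a b ** D c d = cscale (bsign b c) (D (a + c) (b + d))"
proof -
  have "(\<Sum>w\<in>UNIV. D a b $ u $ w * D c d $ w $ v) =
      bsign b c * D (a + c) (b + d) $ u $ v" for u v
  proof -
    have "(\<Sum>w\<in>UNIV. D a b $ u $ w * D c d $ w $ v) =
        (\<Sum>w\<in>UNIV. if w = v + c then D a b $ u $ w * bsign d v else 0)"
      by (intro sum.cong) (auto simp: D_entry simp del: add_bit_eq_xor)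
    also have "\<dots> = D a b $ u $ (v + c) * bsign d v"
      by simp
    also have "\<dots> = bsign b c * D (a + c) (b + d) $ u $ v"
      by (simp add: D_entry bsign_add_right bsign_add_left add.assoc add.commute[of c a])
    finally show ?thesis .
  qed
  then show ?thesis
    by (simp add: vec_eq_iff matrix_matrix_mult_def cscale_def)
qed

lemma D_zero: "D 0 0 = mat 1"
  by (simp add: vec_eq_iff D_entry mat_def)

lemma cscale_cscale: "cscale c (cscale d A) = cscale (c * d) A"
  by (simp add: cscale_def vec_eq_iff mult.assoc)

lemma cscale_mult: "cscale c A ** cscale d B = cscale (c * d) (A ** B)"
  by (simp add: cscale_def vec_eq_iff matrix_matrix_mult_def sum_distrib_left mult_ac)

lemma cscale_one: "cscale 1 A = A"
  by (simp add: cscale_def vec_eq_iff)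

lemma power_i_mod_4: "\<i> ^ (k mod 4) = \<i> ^ k"
proof -
  have "\<i> ^ (4 * (k div 4) + k mod 4) = \<i> ^ (k mod 4)"
    unfolding power_add power_mult by simp
  then show ?thesis by simp
qed

lemma bsign_power_i: "bsign a b = \<i> ^ (2 * dotn a b)"
  by (simp add: bsign_def power_mult)

lemma HW_intro: "cscale (\<i> ^ k) (D a b) \<in> carrier HW"
proof -
  have "cscale (\<i> ^ k) (D a b) = cscale (\<i> ^ (k mod 4)) (D a b)"
    by (simp add: power_i_mod_4)
  moreover have "k mod 4 < 4" by simp
  ultimately show ?thesis
    unfolding HW_def partial_object.select_convs by blast
qed

lemma HW_cases:
  assumes "g \<in> carrier HW" obtains k a b where "g = cscale (\<i> ^ k) (D a b)"
  using assms unfolding HW_def by auto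

lemma HW_mult [simp]: "x \<otimes>\<^bsub>HW\<^esub> y = x ** y" and HW_one [simp]: "\<one>\<^bsub>HW\<^esub> = mat 1"
  by (simp_all add: HW_def)

lemma HW_prod:
  "cscale c (D a b) ** cscale d (D a' b') = cscale (c * d * bsign b a') (D (a + a') (b + b'))"
  by (simp add: cscale_mult D_mult cscale_cscale)

lemma group_HW: "group HW"
proof (rule groupI)
  fix x y :: "'m::finite operator" assume "x \<in> carrier HW" "y \<in> carrier HW"
  then obtain k a b l c d where "x = cscale (\<i> ^ k) (D a b)" "y = cscale (\<i> ^ l) (D c d)"
    by (metis HW_cases)
  then have "x ** y = cscale (\<i> ^ (k + l + 2 * dotn b c)) (D (a + c) (b + d))"
    by (simp add: HW_prod bsign_power_i power_add)
  then show "x \<otimes>\<^bsub>HW\<^esub> y \<in> carrier HW"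
    by (simp add: HW_intro)
next
  show "\<one>\<^bsub>HW\<^esub> \<in> carrier HW"
    using HW_intro[of 0 0 0] by (simp add: D_zero cscale_one)
next
  fix x :: "'m::finite operator" assume "x \<in> carrier HW"
  then obtain k a b where x: "x = cscale (\<i> ^ k) (D a b)" by (metis HW_cases)
  define l where "l = 3 * k + 2 * dotn b a"
  have "\<i> ^ l * \<i> ^ k * bsign b a = \<i> ^ (4 * (k + dotn b a))"
    by (simp add: l_def bsign_power_i flip: power_add)
  also have "\<dots> = 1" unfolding power_mult by simp
  finally have "cscale (\<i> ^ l) (D a b) ** x = mat 1"
    by (simp add: x HW_prod bit_vec_add_self D_zero cscale_one)
  then show "\<exists>y\<in>carrier HW. y \<otimes>\<^bsub>HW\<^esub> x = \<one>\<^bsub>HW\<^esub>"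
    using HW_intro by auto
qed (simp_all add: matrix_mul_assoc)

definition bdot :: "bit ^ 'm::finite \<Rightarrow> bit ^ 'm \<Rightarrow> bit" where
  "bdot a b = (\<Sum>i\<in>UNIV. a $ i * b $ i)"

lemma of_nat_dotn: "of_nat (dotn a b) = bdot a b"
proof -
  have "of_nat (of_bit p * of_bit q) = p * q" for p q :: bit
    by (cases p; cases q) simp_all
  then show ?thesis by (simp only: dotn_def bdot_def of_nat_sum)
qed

lemma even_dotn_iff: "even (dotn a b) \<longleftrightarrow> bdot a b = 0"
proof -
  have "of_nat n = (0::bit) \<longleftrightarrow> even n" for n
    by (induction n) auto
  from this[of "dotn a b"] show ?thesis by (simp only: of_nat_dotn)
qed

lemma bdot_add_left: "bdot (a + c) b = bdot a b + bdot c b"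
  by (simp add: bdot_def algebra_simps sum.distrib del: add_bit_eq_xor mult_bit_eq_and)

lemma bdot_commute: "bdot a b = bdot b a"
  by (simp add: bdot_def mult.commute del: mult_bit_eq_and)

lemma bdot_add_right: "bdot a (b + c) = bdot a b + bdot a c"
  using bdot_add_left[of b c a] by (simp only: bdot_commute)

lemma bdot_sym:
  assumes "transpose P = P"
  shows "bdot (a v* P) c = bdot (c v* P) a"
proof -
  have P: "P $ i $ j = P $ j $ i" for i j
    using assms by (metis transpose_def vec_lambda_beta)
  have "bdot (a v* P) c = (\<Sum>j\<in>UNIV. \<Sum>i\<in>UNIV. a $ i * P $ i $ j * c $ j)"
    by (simp add: bdot_def vector_matrix_mult_def sum_distrib_right del: mult_bit_eq_and)
  also have "\<dots> = (\<Sum>i\<in>UNIV. \<Sum>j\<in>UNIV. a $ i * P $ i $ j * c $ j)"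
    by (rule sum.swap)
  also have "\<dots> = (\<Sum>i\<in>UNIV. \<Sum>j\<in>UNIV. c $ j * P $ j $ i * a $ i)"
    by (intro sum.cong refl) (metis P mult.commute mult.left_commute)
  also have "\<dots> = bdot (c v* P) a"
    by (simp add: bdot_def vector_matrix_mult_def sum_distrib_right del: mult_bit_eq_and)
  finally show ?thesis .
qed

lemma bsign_bdot: "bsign a b = (if bdot a b = 0 then 1 else -1)"
  by (simp add: bsign_def flip: even_dotn_iff)

lemma E_commute:
  assumes "transpose P = P"
  shows "E a (a v* P) ** E c (c v* P) = E c (c v* P) ** E a (a v* P)"
  by (simp add: E_def HW_prod bsign_bdot bdot_sym[OF assms, of a c] add.commute mult.commute)

lemma E_mult:
  assumes "transpose P = P"
  shows "\<exists>s\<in>{1, -1}. E a (a v* P) ** E c (c v* P) = cscale s (E (a + c) ((a + c) v* P))"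
proof -
  define b d where "b = a v* P" and "d = c v* P"
  have bd: "(a + c) v* P = b + d"
    by (simp add: b_def d_def vector_matrix_mult_def vec_eq_iff algebra_simps sum.distrib
        del: add_bit_eq_xor mult_bit_eq_and)
  define k l where "k = dotn a b + dotn c d" and "l = dotn (a + c) (b + d)"
  have "bdot c b = bdot a d"
    using bdot_sym[OF assms, of a c] by (simp add: b_def d_def bdot_commute)
  moreover have "p + (q + (r + q)) = p + r" for p q r :: bit
    by (cases p; cases q; cases r) simp_all
  ultimately have "bdot (a + c) (b + d) = bdot a b + bdot c d"
    by (simp add: bdot_add_left bdot_add_right add_ac del: add_bit_eq_xor)
  moreover have "p + q = 0 \<longleftrightarrow> (p = 0 \<longleftrightarrow> q = 0)" for p q :: bit
    by (cases p; cases q) simp_all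
  ultimately have "even k \<longleftrightarrow> even l"
    by (simp add: k_def l_def even_dotn_iff del: add_bit_eq_xor)
  then have "even (k + 3 * l)" by simp
  then obtain n where n: "k + 3 * l = 2 * n" by (rule evenE)
  define s where "s = bsign b c * (-1) ^ n"
  have "s \<in> {1, -1}"
    using bsign_cases[of b c] by (cases "even n") (auto simp: s_def)
  have "\<i> ^ k = \<i> ^ k * (\<i> ^ 4) ^ l" by simp
  also have "\<dots> = \<i> ^ (k + 3 * l) * \<i> ^ l"
    by (simp only: flip: power_mult power_add) (simp add: algebra_simps)
  also have "\<dots> = (-1) ^ n * \<i> ^ l"
    by (simp only: n power_mult power2_i)
  finally have "E a b ** E c d = cscale s (E (a + c) (b + d))"
    by (simp add: E_def HW_prod cscale_cscale s_def k_def l_def power_add mult_ac)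
  with \<open>s \<in> {1, -1}\<close> show ?thesis
    unfolding bd unfolding b_def d_def by blast
qed

lemma row_mat_mult: "row i (mat 1) v* P = row i P" for P :: "bit ^ 'm::finite ^ 'm"
proof -
  have "(\<Sum>k\<in>UNIV. (if i = k then 1 else 0) * P $ k $ j) = (\<Sum>k\<in>UNIV. if i = k then P $ k $ j else 0)" for j
    by (intro sum.cong) auto
  then show ?thesis
    by (simp add: vec_eq_iff vector_matrix_mult_def row_def mat_def del: mult_bit_eq_and)
qed

lemma E_in_HW: "E a b \<in> carrier HW"
  by (simp add: E_def HW_intro)

lemma E_zero: "E 0 0 = mat 1"
  by (simp add: E_def dotn_def D_zero cscale_one)

lemma generators_subset: "{E (row i (mat 1)) (row i P) | i. True} \<subseteq> carrier HW"
  by (auto simp: E_in_HW)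

lemma subgroup_E_group: "subgroup (E_group P) HW"
  unfolding E_group_def by (rule group.generate_is_subgroup[OF group_HW generators_subset])

lemma E_square: "E a b ** E a b = mat 1"
proof -
  have "\<i> ^ dotn a b * \<i> ^ dotn a b * bsign b a = (\<i> ^ 4) ^ dotn a b"
    by (simp only: bsign_power_i dotn_commute[of b a] flip: power_mult power_add) simp
  then show ?thesis
    by (simp add: E_def HW_prod bit_vec_add_self D_zero cscale_one)
qed

lemma E_group_elem:
  assumes "transpose P = P" "g \<in> E_group P"
  shows "\<exists>s\<in>{1, -1}. \<exists>a. g = cscale s (E a (a v* P))"
proof -
  have gen: "\<exists>s\<in>{1, -1}. \<exists>a. h = cscale s (E a (a v* P))"
    if "h \<in> {E (row i (mat 1)) (row i P) | i. True}" for h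
  proof -
    from that obtain i where "h = E (row i (mat 1)) (row i P)" by blast
    then have "h = cscale 1 (E (row i (mat 1)) (row i (mat 1) v* P))"
      by (simp only: row_mat_mult cscale_one)
    then show ?thesis by blast
  qed
  show ?thesis
    using assms(2) unfolding E_group_def
  proof (induction rule: generate.induct)
    case one
    have "(0 :: bit ^ 'a) v* P = 0" by (simp add: vector_matrix_mult_def vec_eq_iff)
    then show ?case by (intro bexI[of _ 1] exI[of _ 0]) (simp_all add: E_zero cscale_one)
  next
    case (incl h)
    then show ?case by (rule gen)
  next
    case (inv h)
    then have "inv\<^bsub>HW\<^esub> h = h"
      using group.inv_equality[OF group_HW, of h h] generators_subset[of P]
      by (auto simp: E_square E_in_HW)
    with inv gen show ?case by simp
  next
    case (eng h1 h2)
    then obtain s a t c where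
      h: "s \<in> {1, -1}" "h1 = cscale s (E a (a v* P))" "t \<in> {1, -1}" "h2 = cscale t (E c (c v* P))"
      by blast
    from E_mult[OF assms(1)] obtain r where
      r: "r \<in> {1, -1}" "E a (a v* P) ** E c (c v* P) = cscale r (E (a + c) ((a + c) v* P))"
      by blast
    have "h1 \<otimes>\<^bsub>HW\<^esub> h2 = cscale (s * t * r) (E (a + c) ((a + c) v* P))"
      by (simp add: h cscale_mult r cscale_cscale)
    moreover have "s * t * r \<in> {1, -1}" using h r by auto
    ultimately show ?case by blast
  qed
qed

lemma E_group_commute:
  assumes "transpose P = P" "g \<in> E_group P" "h \<in> E_group P"
  shows "g ** h = h ** g"
proof -
  obtain s a t c where "g = cscale s (E a (a v* P))" "h = cscale t (E c (c v* P))"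
    using E_group_elem assms by metis
  then show ?thesis
    by (simp add: cscale_mult E_commute[OF assms(1), of a c] mult.commute)
qed

lemma E_in_E_group_up_to_sign:
  assumes "transpose P = P"
  shows "\<exists>s\<in>{1, -1}. cscale s (E a (a v* P)) \<in> E_group P"
proof -
  let ?Q = "\<lambda>a. \<exists>s\<in>{1, -1}. cscale s (E a (a v* P)) \<in> E_group P"
  have zero: "?Q 0"
  proof -
    have "(0 :: bit ^ 'a) v* P = 0" by (simp add: vector_matrix_mult_def vec_eq_iff)
    then show ?thesis
      using generate.one[of HW]
      by (intro bexI[of _ 1]) (simp_all add: E_zero cscale_one E_group_def)
  qed
  have gen: "?Q (row i (mat 1))" for i
    by (intro bexI[of _ 1])
       (auto simp: row_mat_mult cscale_one E_group_def intro!: generate.incl)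
  have add: "?Q (a + c)" if "?Q a" "?Q c" for a c
  proof -
    from that obtain s t where st: "s \<in> {1, -1}" "cscale s (E a (a v* P)) \<in> E_group P"
      "t \<in> {1, -1}" "cscale t (E c (c v* P)) \<in> E_group P" by blast
    obtain r where r: "r \<in> {1, -1}"
      "E a (a v* P) ** E c (c v* P) = cscale r (E (a + c) ((a + c) v* P))"
      using E_mult[OF assms] by blast
    have "cscale s (E a (a v* P)) ** cscale t (E c (c v* P)) \<in> E_group P"
      using generate.eng[OF st(2)[unfolded E_group_def] st(4)[unfolded E_group_def]]
      by (simp only: HW_mult E_group_def)
    then have "cscale (s * t * r) (E (a + c) ((a + c) v* P)) \<in> E_group P"
      by (simp add: cscale_mult r cscale_cscale)
    moreover have "s * t * r \<in> {1, -1}" using st r by auto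
    ultimately show ?thesis by blast
  qed
  have ind: "?Q (\<chi> i. if i \<in> S then 1 else 0)" if "finite S" for S
    using that
  proof (induction S)
    case empty
    have "(\<chi> i. if i \<in> {} then 1 else 0) = (0 :: bit ^ 'a)" by (simp add: vec_eq_iff)
    with zero show ?case by simp
  next
    case (insert j S)
    have "(\<chi> i. if i \<in> insert j S then 1 else 0) =
        (row j (mat 1) :: bit ^ 'a) + (\<chi> i. if i \<in> S then 1 else 0)"
      using insert.hyps by (auto simp: vec_eq_iff row_def mat_def)
    with add[OF gen insert.IH, of j] show ?case by simp
  qed
  have "a = (\<chi> i. if i \<in> {i. a $ i = 1} then 1 else 0)"
    by (auto simp: vec_eq_iff)
  with ind[of "{i. a $ i = 1}"] show ?thesis by simp
qed

text \<open>
  Every element of the generated group is \<open>\<plusminus>E a (a v* P)\<close>, so the scalar \<open>\<i>\<close> is missing although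
  it commutes with everything. The group is a maximal commutative subgroup up to scalars:
  whatever commutes with all its elements is a power of \<open>\<i>\<close> times one of them.
\<close>

lemma E_group_maximal:
  fixes g :: "'m::finite operator"
  assumes "transpose P = P" "g \<in> carrier HW" "\<And>h. h \<in> E_group P \<Longrightarrow> g ** h = h ** g"
  shows "\<exists>k. \<exists>h\<in>E_group P. g = cscale (\<i> ^ k) h"
proof -
  obtain k a b where g: "g = cscale (\<i> ^ k) (D a b)" using assms(2) by (rule HW_cases)
  have cscale_D_inj: "c = d" if "cscale c (D u v) = cscale d (D u v)" for c d and u v :: "bit ^ 'm"
  proof -
    have "cscale c (D u v) $ u $ 0 = cscale d (D u v) $ u $ 0" using that by simp
    then show ?thesis by (simp add: cscale_def D_entry)
  qed
  have "b $ i = (a v* P) $ i" for i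
  proof -
    let ?e = "row i (mat 1) :: bit ^ 'm"
    have "E ?e (row i P) \<in> E_group P"
      unfolding E_group_def by (rule generate.incl) auto
    from assms(3)[OF this] have
      "\<i> ^ k * \<i> ^ dotn ?e (row i P) * bsign b ?e = \<i> ^ dotn ?e (row i P) * \<i> ^ k * bsign (row i P) a"
      unfolding g E_def HW_prod add.commute[of ?e a] add.commute[of "row i P" b]
      by (rule cscale_D_inj)
    then have "bsign b ?e = bsign (row i P) a" by simp
    then have "bdot b ?e = 0 \<longleftrightarrow> bdot (?e v* P) a = 0"
      by (auto simp: bsign_bdot row_mat_mult split: if_splits)
    then have *: "bdot b ?e = 0 \<longleftrightarrow> bdot (a v* P) ?e = 0"
      by (simp add: bdot_sym[OF assms(1), of a ?e])
    have "bdot v ?e = v $ i" for v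
    proof -
      have "bdot v ?e = (\<Sum>j\<in>UNIV. if i = j then v $ j else 0)"
        unfolding bdot_def by (intro sum.cong) (auto simp: row_def mat_def)
      then show ?thesis by simp
    qed
    with * have "b $ i = 0 \<longleftrightarrow> (a v* P) $ i = 0" by (simp only:)
    then show ?thesis by (cases "b $ i"; cases "(a v* P) $ i") simp_all
  qed
  then have b: "b = a v* P" by (simp add: vec_eq_iff)
  obtain s where s: "s \<in> {1, -1}" "cscale s (E a b) \<in> E_group P"
    using E_in_E_group_up_to_sign[OF assms(1)] b by blast
  define l where "l = k + 3 * dotn a b + (if s = 1 then 0 else 2)"
  have "\<i> ^ l * (s * \<i> ^ dotn a b) = \<i> ^ k * (\<i> ^ 4) ^ dotn a b"
    using s(1) by (auto simp: l_def power_add simp flip: power_mult)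
      (simp_all flip: power_add power_mult)
  then have "g = cscale (\<i> ^ l) (cscale s (E a b))"
    by (simp add: g E_def cscale_cscale mult.assoc)
  with s(2) show ?thesis by blast
qed

end

theory Submission
  imports Defs
begin

text \<open>
  Lift \<open>x, y\<close> to integer vectors and write \<open>x + y = z + 2d\<close>, where \<open>z\<close> lifts the binary sum and
  \<open>d\<close> is the vector of carries. The integer form of the symmetric matrix \<open>P\<close> then satisfies
  \<open>zPz\<^sup>T \<equiv> xPx\<^sup>T + yPy\<^sup>T + 2xPy\<^sup>T\<close> modulo 4. Hence shifting the argument of the vector by \<open>a\<close>
  multiplies its entry at \<open>u\<close> by a constant and by the sign \<open>(-1)\<close> to the power \<open>(aP)u\<^sup>T\<close>, and the
  diagonal part of \<open>E(a, aP)\<close> cancels exactly that sign.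
\<close>

text \<open>The arguments are functions into the naturals rather than bit vectors, because the
  expansion below inserts integer sums and doubled carries, whose entries can be 2.\<close>

definition bform :: "bit ^ 'm::finite ^ 'm \<Rightarrow> ('m \<Rightarrow> nat) \<Rightarrow> ('m \<Rightarrow> nat) \<Rightarrow> nat" where
  "bform P f g = (\<Sum>i\<in>UNIV. \<Sum>j\<in>UNIV. f i * of_bit (P $ i $ j) * g j)"

lemma quadn_eq_bform: "quadn P x = bform P (\<lambda>i. of_bit (x $ i)) (\<lambda>i. of_bit (x $ i))"
  by (simp add: quadn_def bform_def)

lemma bform_add_left: "bform P (\<lambda>i. f i + f' i) g = bform P f g + bform P f' g"
  by (simp add: bform_def algebra_simps sum.distrib)

lemma bform_add_right: "bform P f (\<lambda>i. g i + g' i) = bform P f g + bform P f g'"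
  by (simp add: bform_def algebra_simps sum.distrib)

lemma bform_double_left: "bform P (\<lambda>i. 2 * f i) g = 2 * bform P f g"
  by (simp add: bform_def sum_distrib_left mult.assoc)

lemma bform_double_right: "bform P f (\<lambda>i. 2 * g i) = 2 * bform P f g"
  by (simp add: bform_def sum_distrib_left mult_ac)

lemma bform_commute:
  assumes "transpose P = P"
  shows "bform P f g = bform P g f"
proof -
  have P: "P $ i $ j = P $ j $ i" for i j
    using assms by (metis transpose_def vec_lambda_beta)
  have "bform P f g = (\<Sum>j\<in>UNIV. \<Sum>i\<in>UNIV. f i * of_bit (P $ i $ j) * g j)"
    unfolding bform_def by (rule sum.swap)
  also have "\<dots> = bform P g f"
    unfolding bform_def by (intro sum.cong refl) (metis P mult.commute mult.left_commute)
  finally show ?thesis .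
qed

lemma power_i_quadn_add:
  assumes "transpose P = P"
  shows "\<i> ^ quadn P (x + y) =
    \<i> ^ quadn P x * \<i> ^ quadn P y * (-1) ^ bform P (\<lambda>i. of_bit (x $ i)) (\<lambda>i. of_bit (y $ i))"
proof -
  define f g h c :: "'a \<Rightarrow> nat" where "f = (\<lambda>i. of_bit (x $ i))" and "g = (\<lambda>i. of_bit (y $ i))"
    and "h = (\<lambda>i. of_bit ((x + y) $ i))" and "c = (\<lambda>i. of_bit (x $ i) * of_bit (y $ i))"
  have "of_bit p + of_bit q = (of_bit (p + q) + 2 * (of_bit p * of_bit q) :: nat)" for p q :: bit
    by (cases p; cases q) simp_all
  then have carry: "(\<lambda>i. f i + g i) = (\<lambda>i. h i + 2 * c i)"
    by (simp only: f_def g_def h_def c_def vector_add_component)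
  have "bform P f f + bform P g g + 2 * bform P f g = bform P (\<lambda>i. f i + g i) (\<lambda>i. f i + g i)"
    by (simp add: bform_add_left bform_add_right bform_commute[OF assms, of g f])
  \<comment> \<open>By symmetry the two cross terms agree, so together they give 4 times
    \<open>bform P h c\<close>; a power of \<i> does not see multiples of 4.\<close>
  also have "\<dots> = bform P h h + 4 * (bform P h c + bform P c c)"
    unfolding carry
    by (simp add: bform_add_left bform_add_right bform_double_left bform_double_right
        bform_commute[OF assms, of c h])
  finally have "\<i> ^ (bform P f f + bform P g g + 2 * bform P f g) =
      \<i> ^ (bform P h h + 4 * (bform P h c + bform P c c))"
    by simp
  then show ?thesis
    by (simp add: power_add power_mult quadn_eq_bform f_def g_def h_def del: add_bit_eq_xor)
qed

text \<open>A sign depends only on the parity of its exponent, so reducing the entries of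
  \<open>x v* P\<close> modulo 2 is harmless.\<close>

lemma bsign_vector_matrix_mult:
  "bsign (x v* P) y = (-1) ^ bform P (\<lambda>i. of_bit (x $ i)) (\<lambda>i. of_bit (y $ i))"
proof -
  have lift: "of_nat (of_bit p * of_bit q * of_bit r) = p * q * r" for p q r :: bit
    by (cases p; cases q; cases r) simp_all
  have "bdot (x v* P) y = (\<Sum>j\<in>UNIV. \<Sum>i\<in>UNIV. x $ i * P $ i $ j * y $ j)"
    by (simp add: bdot_def vector_matrix_mult_def sum_distrib_right del: mult_bit_eq_and)
  also have "\<dots> = (\<Sum>i\<in>UNIV. \<Sum>j\<in>UNIV. x $ i * P $ i $ j * y $ j)"
    by (rule sum.swap)
  also have "\<dots> = of_nat (bform P (\<lambda>i. of_bit (x $ i)) (\<lambda>i. of_bit (y $ i)))"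
    by (simp only: bform_def of_nat_sum lift)
  finally have "bdot (x v* P) y = of_nat (bform P (\<lambda>i. of_bit (x $ i)) (\<lambda>i. of_bit (y $ i)))" .
  moreover have "of_nat n = (0::bit) \<longleftrightarrow> even n" for n
    by (induction n) auto
  ultimately show ?thesis
    by (simp add: bsign_bdot)
qed

text \<open>The part of the exponent with \<open>w\<close> contributes only the sign
  \<open>bsign w\<close>, which is multiplicative; the remaining factor comes from the quadratic
  part.\<close>

lemma eigvec_add:
  assumes "transpose P = P"
  shows "eigvec P w $ (u + a) = eigvec P w $ a * bsign (a v* P) u * eigvec P w $ u"
  by (simp add: eigvec_def power_add power_i_quadn_add[OF assms, of a u] add.commute[of u a]
      bsign_vector_matrix_mult bsign_add_right flip: bsign_power_i)

text \<open>Row \<open>u\<close> has its only nonzero entry in column \<open>u + a\<close>, since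
  \<open>a\<close> is its own negative.\<close>

lemma D_mult_vec: "(D a b *v \<psi>) $ u = bsign b (u + a) * \<psi> $ (u + a)"
proof -
  have shift: "u = v + a \<longleftrightarrow> v = u + a" for v
    by (metis add.assoc add.right_neutral bit_vec_add_self)
  have "(D a b *v \<psi>) $ u = (\<Sum>v\<in>UNIV. if v = u + a then bsign b v * \<psi> $ v else 0)"
    unfolding matrix_vector_mult_def vec_lambda_beta D_entry shift
    by (intro sum.cong) auto
  then show ?thesis by simp
qed

lemma cscale_mult_vec: "cscale c A *v \<psi> = c *s (A *v \<psi>)"
  by (simp add: cscale_def vec_eq_iff matrix_vector_mult_def sum_distrib_left mult.assoc)

lemma E_mult_eigvec:
  assumes "transpose P = P"
  shows "E a (a v* P) *v eigvec P w =
    (\<i> ^ dotn a (a v* P) * bsign (a v* P) a * eigvec P w $ a) *s eigvec P w"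
proof -
  \<comment> \<open>The sign depending on \<open>u\<close> arises twice, from the diagonal part of
    \<open>D\<close> and from the shift of the vector. Only factors independent of \<open>u\<close>
    remain, and they form the eigenvalue.\<close>
  have "bsign (a v* P) u * bsign (a v* P) u = 1" for u
    using bsign_cases[of "a v* P" u] by auto
  then show ?thesis
    by (simp add: vec_eq_iff E_def cscale_mult_vec D_mult_vec eigvec_add[OF assms]
        bsign_add_right)
qed

text \<open>Each of the \<open>2 ^ CARD('m)\<close> entries is a power of \<i>, hence of modulus
  1.\<close>

lemma norm_eigvec: "norm (eigvec P w) = sqrt (2 ^ CARD('m))"
  for P :: "bit ^ 'm::finite ^ 'm"
  by (simp add: norm_vec_def L2_set_def eigvec_def norm_power UNIV_bit)

theorem lemma11:
  fixes P :: "bit ^ 'm::finite ^ 'm"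
  assumes "transpose P = P"
  shows "\<forall>w :: bit ^ 'm.
           common_eigenvector (E_group P) (eigvec P w) \<and>
           norm (eigvec P w) = sqrt (2 ^ CARD('m)) \<and>
           norm (eigvec P w) = 2 powr (real CARD('m) / 2)"
proof
  fix w :: "bit ^ 'm"
  have "eigvec P w \<noteq> 0"
    using norm_eigvec[of P w] by auto
  moreover have "\<exists>c. A *v eigvec P w = c *s eigvec P w" if A: "A \<in> E_group P" for A
  proof -
    \<comment> \<open>The sign \<open>s\<close> only rescales the eigenvalue of
      \<open>E a (a v* P)\<close>.\<close>
    obtain s a where "A = cscale s (E a (a v* P))"
      using E_group_elem[OF assms A] by blast
    then show ?thesis
      by (auto simp: cscale_mult_vec E_mult_eigvec[OF assms] vector_smult_assoc)
  qed
  moreover have "sqrt (2 ^ CARD('m)) = 2 powr (real CARD('m) / 2)"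
    by (simp add: powr_half_sqrt_powr powr_realpow)
  ultimately show "common_eigenvector (E_group P) (eigvec P w) \<and>
      norm (eigvec P w) = sqrt (2 ^ CARD('m)) \<and>
      norm (eigvec P w) = 2 powr (real CARD('m) / 2)"
    by (simp add: common_eigenvector_def norm_eigvec)
qed

end
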